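(* Let $k\in\mathbb{N}$, let $H_k\in\mathbb{R}^{l\times l}$ be symmetric positive definite, let $G_k\in\mathbb{R}^{q\times l}$ have rank $l$, let $R_k\in\mathbb{R}^{l\times l}$ be invertible, and define $\tilde H_k:=R_k^\top H_kR_k$ and $\tilde G_k:=G_kR_k$. Let $$\tilde G_k\tilde H_k^{-1}\tilde G_k^\top=\tilde U_k\tilde\Sigma_k\tilde V_k^\top$$ be a singular value decomposition, where $\tilde U_k=\begin{pmatrix}\tilde u_{1,k}&\dots&\tilde u_{q,k}\end{pmatrix}\in\mathbb{R}^{q\times q}$ and $\tilde V_k\in\mathbb{R}^{q\times q}$ are orthogonal and $$\tilde\Sigma_k=\begin{pmatrix}\tilde D_k&0\\0&0\end{pmatrix}\in\mathbb{R}^{q\times q},\qquad \tilde D_k:=\operatorname{diag}(\tilde\sigma_{1,k},\dots,\tilde\sigma_{l,k}),\qquad \tilde\sigma_{1,k}\ge\dots\ge\tilde\sigma_{l,k}>0.$$ Then the guess with the parameters $$\hat H_k:=\tilde D_k^{-1},\qquad \hat G_k:=\begin{pmatrix}\tilde u_{1,k}&\dots&\tilde u_{l,k}\end{pmatrix},\qquad \hat R_k:=\hat G_k^\top\tilde G_k$$ is consistent, in the sense that $$\tilde H_k=\hat R_k^\top\hat H_k\hat R_k\qquad\text{and}\qquad \tilde G_k=\hat G_k\hat R_k.$$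
   Context: The dimensions $l,q\in\mathbb{N}$ are constant. The matrix $\tilde G_k\tilde H_k^{-1}\tilde G_k^\top$ has rank $l$ under the stated assumptions, so it has exactly $l$ positive singular values $\tilde\sigma_{1,k},\dots,\tilde\sigma_{l,k}$. The vectors $\tilde u_{1,k},\dots,\tilde u_{q,k}$ are the columns of $\tilde U_k$. *)

theory Defs
  imports
    Complex_Main
    "Jordan_Normal_Form.Gauss_Jordan_Elimination"
    "Jordan_Normal_Form.DL_Rank"
begin

definition sym_pos_def_mat :: "nat \<Rightarrow> real mat \<Rightarrow> bool" where
  "sym_pos_def_mat n A \<longleftrightarrow>
     A \<in> carrier_mat n n \<and> A\<^sup>T = A \<and>
     (\<forall>x \<in> carrier_vec n. x \<noteq> 0\<^sub>v n \<longrightarrow> 0 < x \<bullet> (A *\<^sub>v x))"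

(* The library's orthogonal_mat only asks for pairwise orthogonal non-zero columns,
   without normalisation, so it is not used here. *)
definition real_orthogonal_mat :: "nat \<Rightarrow> real mat \<Rightarrow> bool" where
  "real_orthogonal_mat n U \<longleftrightarrow>
     U \<in> carrier_mat n n \<and> U\<^sup>T * U = 1\<^sub>m n \<and> U * U\<^sup>T = 1\<^sub>m n"

(* Meaningful only for invertible square matrices; unspecified otherwise. *)
definition mat_inv :: "real mat \<Rightarrow> real mat" where
  "mat_inv A = the (mat_inverse A)"

end

theory Submission
  imports Defs
begin

text \<open>
  Write the decomposition in thin form as \<open>X K X\<^sup>T = U D V\<^sup>T\<close>, where \<open>K\<close> is the inverse of the
  transformed Hessian, \<open>X\<close> the transformed matrix \<open>G\<close>, and \<open>U\<close>, \<open>V\<close> consist of the first \<open>l\<close>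
  singular vectors. If \<open>U\<^sup>T w = 0\<close>, then \<open>X K X\<^sup>T w = V D U\<^sup>T w = 0\<close> by symmetry, and
  positive definiteness of \<open>K\<close> yields \<open>X\<^sup>T w = 0\<close>; hence \<open>X = U U\<^sup>T X\<close>. The compression
  \<open>B = U\<^sup>T X K X\<^sup>T U\<close> is positive semidefinite and satisfies \<open>B\<^sup>2 = D\<^sup>2\<close>, so \<open>B = D\<close> by
  uniqueness of positive square roots. Inverting \<open>B = D\<close> gives the formula for the Hessian.
\<close>

section \<open>Matrix products and inverses\<close>

text \<open>Side conditions on dimensions, unlike carrier conditions, leave no sizes to guess, so
  the simplifier can discharge them when it reassociates long products.\<close>

lemma mult_assoc_dim:
  fixes A B C :: "real mat"
  assumes "dim_col A = dim_row B" "dim_col B = dim_row C"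
  shows "A * B * C = A * (B * C)"
  using assms by (intro assoc_mult_mat) auto

lemma transpose_mult_dim:
  fixes A B :: "real mat"
  assumes "dim_col A = dim_row B"
  shows "(A * B)\<^sup>T = B\<^sup>T * A\<^sup>T"
  using assms by (intro transpose_mult) auto

lemma mat_inv_unique:
  assumes A: "A \<in> carrier_mat n n" and B: "B \<in> carrier_mat n n" and BA: "B * A = 1\<^sub>m n"
  shows "mat_inv A = B"
proof -
  have AB: "A * B = 1\<^sub>m n"
    using mat_mult_left_right_inverse[OF B A BA] .
  \<comment> \<open>\<open>None\<close> would mean that \<open>A\<close> is not a unit of the matrix
    ring, which the two-sided inverse \<open>B\<close> refutes; \<open>b = ()\<close> instantiates
    the record extension of \<open>ring_mat\<close>.\<close>
  have "mat_inverse A \<noteq> None"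
    using mat_inverse(1)[OF A, where b = "()"] A B AB BA
    unfolding Units_def by (auto simp: ring_mat_def)
  then obtain C where C: "mat_inverse A = Some C" by auto
  note C' = mat_inverse(2)[OF A C]
  have "C = C * (A * B)" using AB C' by auto
  also have "\<dots> = (C * A) * B" using assoc_mult_mat[OF _ A B, of C n] C' by simp
  also have "\<dots> = B" using B C' by auto
  finally show ?thesis using C by (simp add: mat_inv_def)
qed

lemma mat_inv_nonsingular:
  assumes A: "A \<in> carrier_mat n n" and "det A \<noteq> 0"
  shows "mat_inv A \<in> carrier_mat n n" "mat_inv A * A = 1\<^sub>m n" "A * mat_inv A = 1\<^sub>m n"
proof -
  have "A \<in> Units (ring_mat TYPE(real) n ())"
    using det_non_zero_imp_unit[OF assms] .
  with mat_inverse(1)[OF A, where b = "()"] obtain C where C: "mat_inverse A = Some C" by (cases "mat_inverse A") auto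
  show "mat_inv A \<in> carrier_mat n n" "mat_inv A * A = 1\<^sub>m n" "A * mat_inv A = 1\<^sub>m n"
    using mat_inverse(2)[OF A C] C by (auto simp: mat_inv_def)
qed

lemma mat_inv_mat_diag:
  assumes "\<forall>i<n. d i \<noteq> 0"
  shows "mat_inv (mat_diag n d) = mat_diag n (\<lambda>i. inverse (d i))"
proof (rule mat_inv_unique)
  show "mat_diag n (\<lambda>i. inverse (d i)) * mat_diag n d = 1\<^sub>m n"
    using assms by (subst mat_diag_mult_left[of _ n n]) (auto simp: mat_diag_def)
qed auto

section \<open>Positive definiteness under congruence and inversion\<close>

lemma quadratic_form_congruence:
  fixes A P :: "real mat"
  assumes "A \<in> carrier_mat n n" "P \<in> carrier_mat n m" "x \<in> carrier_vec m"
  shows "x \<bullet> ((P\<^sup>T * A * P) *\<^sub>v x) = (P *\<^sub>v x) \<bullet> (A *\<^sub>v (P *\<^sub>v x))"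
proof -
  have "(P\<^sup>T * A * P) *\<^sub>v x = P\<^sup>T *\<^sub>v (A *\<^sub>v (P *\<^sub>v x))"
    using assoc_mult_mat_vec[of "P\<^sup>T * A" m n P m x] assoc_mult_mat_vec[of "P\<^sup>T" m n A n "P *\<^sub>v x"]
      assms by simp
  moreover have "x \<bullet> (P\<^sup>T *\<^sub>v y) = (P *\<^sub>v x) \<bullet> y" if y: "y \<in> carrier_vec n" for y
    using transpose_vec_mult_scalar[OF assms(2,3) y] assms y
    by (metis comm_scalar_prod mult_mat_vec_carrier transpose_carrier_mat)
  ultimately show ?thesis using assms by auto
qed

text \<open>The left inverse \<open>Q\<close> makes \<open>P\<close> injective, so a nonzero
  \<open>x\<close> gives a nonzero \<open>P *\<^sub>v x\<close>, at which the form of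
  \<open>A\<close> is positive.\<close>

lemma sym_pos_def_congruence:
  assumes A: "sym_pos_def_mat n A" and P: "P \<in> carrier_mat n m"
    and Q: "Q \<in> carrier_mat m n" and QP: "Q * P = 1\<^sub>m m"
  shows "sym_pos_def_mat m (P\<^sup>T * A * P)"
  unfolding sym_pos_def_mat_def
proof (intro conjI ballI impI)
  have Ac: "A \<in> carrier_mat n n" and As: "A\<^sup>T = A"
    using A by (auto simp: sym_pos_def_mat_def)
  show "P\<^sup>T * A * P \<in> carrier_mat m m" using Ac P by auto
  show "(P\<^sup>T * A * P)\<^sup>T = P\<^sup>T * A * P"
    using Ac P by (simp add: transpose_mult_dim mult_assoc_dim As)
  fix x :: "real vec" assume x: "x \<in> carrier_vec m" "x \<noteq> 0\<^sub>v m"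
  have "P *\<^sub>v x \<noteq> 0\<^sub>v n"
  proof
    assume "P *\<^sub>v x = 0\<^sub>v n"
    then have "Q *\<^sub>v (P *\<^sub>v x) = 0\<^sub>v m" using Q by auto
    moreover have "Q *\<^sub>v (P *\<^sub>v x) = x"
      using P Q x QP by (simp flip: assoc_mult_mat_vec)
    ultimately show False using x by simp
  qed
  then have "0 < (P *\<^sub>v x) \<bullet> (A *\<^sub>v (P *\<^sub>v x))"
    using A P x by (auto simp: sym_pos_def_mat_def)
  then show "0 < x \<bullet> ((P\<^sup>T * A * P) *\<^sub>v x)"
    using quadratic_form_congruence[OF Ac P x(1)] by simp
qed

lemma sym_pos_def_det_nonzero:
  assumes "sym_pos_def_mat n A"
  shows "det A \<noteq> 0"
proof
  assume "det A = 0"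
  moreover have "A \<in> carrier_mat n n" using assms by (simp add: sym_pos_def_mat_def)
  ultimately obtain v where v: "v \<in> carrier_vec n" "v \<noteq> 0\<^sub>v n" "A *\<^sub>v v = 0\<^sub>v n"
    using det_0_iff_vec_prod_zero by blast
  then have "0 < v \<bullet> 0\<^sub>v n" using assms by (metis sym_pos_def_mat_def)
  then show False using v by simp
qed

text \<open>By symmetry the inverse \<open>K\<close> of \<open>A\<close> satisfies
  \<open>K\<^sup>T * A = 1\<close>, hence \<open>K\<^sup>T * A * K = K\<close>: the inverse is
  congruent to \<open>A\<close>.\<close>

lemma sym_pos_def_mat_inv:
  assumes A: "sym_pos_def_mat n A"
  shows "sym_pos_def_mat n (mat_inv A)"
proof -
  have Ac: "A \<in> carrier_mat n n" and As: "A\<^sup>T = A"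
    using A by (auto simp: sym_pos_def_mat_def)
  note inv = mat_inv_nonsingular[OF Ac sym_pos_def_det_nonzero[OF A]]
  have "(mat_inv A)\<^sup>T * A = 1\<^sub>m n"
    using arg_cong[OF inv(3), of transpose_mat] Ac inv(1) As by (simp add: transpose_mult_dim)
  then have "(mat_inv A)\<^sup>T * A * mat_inv A = mat_inv A"
    using inv(1) by simp
  then show ?thesis
    using sym_pos_def_congruence[OF A inv(1) Ac inv(3)] by simp
qed

text \<open>The diagonal entries of \<open>N\<^sup>T * A * N\<close> are the values of the form of
  \<open>A\<close> at the columns of \<open>N\<close>; where they vanish, definiteness kills the
  column.\<close>

lemma sym_pos_def_congruence_zero:
  assumes A: "sym_pos_def_mat n A" and N: "N \<in> carrier_mat n m"
    and zero: "N\<^sup>T * A * N = 0\<^sub>m m m"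
  shows "N = 0\<^sub>m n m"
proof (rule eq_matI)
  have Ac: "A \<in> carrier_mat n n" using A by (simp add: sym_pos_def_mat_def)
  fix i j assume ij: "i < dim_row (0\<^sub>m n m)" "j < dim_col (0\<^sub>m n m)"
  have e: "N *\<^sub>v unit_vec m j = col N j"
    using N ij by (intro eq_vecI) auto
  have "col N j \<bullet> (A *\<^sub>v col N j) = unit_vec m j \<bullet> ((N\<^sup>T * A * N) *\<^sub>v unit_vec m j)"
    using quadratic_form_congruence[OF Ac N, of "unit_vec m j"] e by simp
  also have "\<dots> = 0" unfolding zero using ij by (simp add: scalar_prod_def)
  finally have "col N j = 0\<^sub>v n"
    using A N unfolding sym_pos_def_mat_def
    by (metis carrier_matD(1) col_dim order_less_irrefl)
  then have "col N j $ i = 0" using ij by simp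
  then show "N $$ (i, j) = 0\<^sub>m n m $$ (i, j)" using N ij by simp
qed (use N in auto)

section \<open>Positive square roots and the thin decomposition\<close>

text \<open>\<open>B\<close> commutes with its own square, hence with the diagonal matrix
  \<open>D\<close>, so \<open>(B + D) * (B - D) = 0\<close>. On each column of \<open>B - D\<close>
  the nonnegative forms of \<open>B\<close> and \<open>D\<close> then sum to zero, and
  \<open>D\<close> is definite.\<close>

lemma psd_square_root_unique_diag:
  fixes d :: "nat \<Rightarrow> real"
  assumes B: "B \<in> carrier_mat n n"
    and psd: "\<And>x. x \<in> carrier_vec n \<Longrightarrow> 0 \<le> x \<bullet> (B *\<^sub>v x)"
    and d: "\<forall>i<n. 0 < d i"
    and sq: "B * B = mat_diag n d * mat_diag n d"
  shows "B = mat_diag n d"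
proof -
  let ?D = "mat_diag n d"
  define e where "e = (\<lambda>i. d i * d i)"
  have D: "?D \<in> carrier_mat n n" by simp
  have sq': "B * B = mat_diag n e" using sq by (simp add: e_def)
  have "B * mat_diag n e = mat_diag n e * B"
    using B by (simp flip: sq' add: mult_assoc_dim)
  then have comm_sq: "B $$ (i, j) * e j = e i * B $$ (i, j)" if "i < n" "j < n" for i j
    using that B
    by (subst (asm) mat_diag_mult_left[OF B], subst (asm) mat_diag_mult_right[OF B])
      (drule arg_cong[of _ _ "\<lambda>M. M $$ (i, j)"], simp)
  \<comment> \<open>A nonzero entry of \<open>B\<close> can only link indices with equal squares,
    and equal squares of positive numbers come from equal numbers.\<close>
  have comm: "B $$ (i, j) * d j = d i * B $$ (i, j)" if ij: "i < n" "j < n" for i j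
  proof (cases "B $$ (i, j) = 0")
    case False
    then have "(d j)\<^sup>2 = (d i)\<^sup>2"
      using comm_sq[OF ij] by (simp add: e_def power2_eq_square)
    then have "d j = d i"
      using d ij by (metis less_imp_le power2_eq_imp_eq)
    then show ?thesis by simp
  qed simp
  have BD: "B * ?D = ?D * B"
    using B comm
    by (subst mat_diag_mult_left[OF B], subst mat_diag_mult_right[OF B]) auto
  have C: "B - ?D \<in> carrier_mat n n" by (rule minus_carrier_mat[OF D])
  have "B * (B - ?D) = B * B - ?D * B"
    using mult_minus_distrib_mat[OF B B D] BD by simp
  moreover have "?D * (B - ?D) = ?D * B - B * B"
    using mult_minus_distrib_mat[OF D B D] sq by simp
  ultimately have key: "(B * (B - ?D)) $$ (i, j) + (?D * (B - ?D)) $$ (i, j) = 0"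
    if "i < n" "j < n" for i j
    using that B carrier_matD[OF D] by (simp del: index_mult_mat(1))
  have entry: "(B - ?D) $$ (i, j) = 0" if ij: "i < n" "j < n" for i j
  proof -
    define c where "c = col (B - ?D) j"
    have c: "c \<in> carrier_vec n" using col_dim[of "B - ?D" j] unfolding c_def carrier_matD(1)[OF C] .
    have "B *\<^sub>v c + ?D *\<^sub>v c = 0\<^sub>v n"
    proof (rule eq_vecI)
      fix a assume "a < dim_vec (0\<^sub>v n)"
      then show "(B *\<^sub>v c + ?D *\<^sub>v c) $ a = 0\<^sub>v n $ a"
        using key[of a j] ij B carrier_matD[OF C] carrier_matD[OF D] by (simp add: c_def)
    qed (use carrier_matD[OF D] in simp)
    then have "c \<bullet> (B *\<^sub>v c) + c \<bullet> (?D *\<^sub>v c) = 0"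
      using c B D by (metis mult_mat_vec_carrier scalar_prod_add_distrib scalar_prod_right_zero)
    then have le: "c \<bullet> (?D *\<^sub>v c) \<le> 0" using psd[OF c] by linarith
    have Dc: "?D *\<^sub>v c = vec n (\<lambda>a. d a * c $ a)"
    proof (rule eq_vecI)
      fix a assume a: "a < dim_vec (vec n (\<lambda>a. d a * c $ a))"
      then have "(?D *\<^sub>v c) $ a = (\<Sum>b = 0..<n. (if a = b then d b else 0) * c $ b)"
        using c by (simp add: mat_diag_def scalar_prod_def)
      also have "\<dots> = (\<Sum>b = 0..<n. if b = a then d a * c $ a else 0)"
        by (rule sum.cong) auto
      finally show "(?D *\<^sub>v c) $ a = vec n (\<lambda>a. d a * c $ a) $ a" using a by simp
    qed (use carrier_matD[OF D] in simp)
    have sum: "c \<bullet> (?D *\<^sub>v c) = (\<Sum>a = 0..<n. d a * (c $ a)\<^sup>2)"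
      unfolding Dc by (auto simp: scalar_prod_def power2_eq_square intro!: sum.cong)
    have nonneg: "0 \<le> d a * (c $ a)\<^sup>2" if "a \<in> {0..<n}" for a
      using d that by (simp add: less_imp_le)
    have "(\<Sum>a = 0..<n. d a * (c $ a)\<^sup>2) = 0"
      using le sum sum_nonneg[of "{0..<n}" "\<lambda>a. d a * (c $ a)\<^sup>2"] nonneg by simp
    then have "d i * (c $ i)\<^sup>2 = 0"
      using sum_nonneg_eq_0_iff[of "{0..<n}" "\<lambda>a. d a * (c $ a)\<^sup>2"] nonneg ij by simp
    then have "c $ i = 0" using d ij by force
    then show ?thesis
      using ij carrier_matD[OF C] by (simp add: c_def del: index_minus_mat)
  qed
  show ?thesis
    using entry B carrier_matD[OF D] by (intro eq_matI) auto
qed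

text \<open>Since \<open>V\<close> may differ from \<open>U\<close>, the compression to the range of
  \<open>U\<close> cannot be read off directly; its square can, because \<open>V\<close> cancels
  there through \<open>V\<^sup>T * V = 1\<close>.\<close>

lemma thin_svd_of_congruence:
  fixes d :: "nat \<Rightarrow> real"
  assumes K: "sym_pos_def_mat l K" and X: "X \<in> carrier_mat q l"
    and U: "U \<in> carrier_mat q l" and V: "V \<in> carrier_mat q l"
    and UU: "U\<^sup>T * U = 1\<^sub>m l" and VV: "V\<^sup>T * V = 1\<^sub>m l"
    and d: "\<forall>i<l. 0 < d i"
    and svd: "X * K * X\<^sup>T = U * mat_diag l d * V\<^sup>T"
  shows "X = U * (U\<^sup>T * X)" and "(U\<^sup>T * X) * K * (U\<^sup>T * X)\<^sup>T = mat_diag l d"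
proof -
  let ?D = "mat_diag l d"
  define P where "P = U * U\<^sup>T"
  define A where "A = X * K * X\<^sup>T"
  define N where "N = X\<^sup>T * (1\<^sub>m q - P)"
  have Kc: "K \<in> carrier_mat l l" and Ks: "K\<^sup>T = K"
    using K by (auto simp: sym_pos_def_mat_def)
  have Ds: "?D\<^sup>T = ?D" by (intro eq_matI) (auto simp: mat_diag_def)
  have D: "?D \<in> carrier_mat l l" by simp
  have dimD: "dim_row ?D = l" "dim_col ?D = l" using carrier_matD[OF D] .
  have P: "P \<in> carrier_mat q q" using U by (simp add: P_def)
  have Ps: "P\<^sup>T = P" using U by (simp add: P_def transpose_mult_dim)
  have A: "A \<in> carrier_mat q q" using X Kc by (simp add: A_def)
  have As: "A\<^sup>T = A"
    using X Kc Ks by (simp add: A_def transpose_mult_dim mult_assoc_dim)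
  have A1: "A = U * (?D * V\<^sup>T)"
    unfolding A_def svd using U V dimD by (simp add: mult_assoc_dim)
  \<comment> \<open>Transposing the symmetric \<open>A\<close> swaps \<open>U\<close> and
    \<open>V\<close>. With \<open>U\<^sup>T\<close> on the right, the projection \<open>P\<close>
    onto the range of \<open>U\<close> is absorbed.\<close>
  have A2: "A = V * (?D * U\<^sup>T)"
    using As U V dimD unfolding A1 by (simp add: transpose_mult_dim mult_assoc_dim Ds)
  have UP: "U\<^sup>T * P = U\<^sup>T"
  proof -
    have "U\<^sup>T * P = (U\<^sup>T * U) * U\<^sup>T" using U by (simp add: P_def mult_assoc_dim)
    then show ?thesis using U by (simp add: UU)
  qed
  have AP: "A * P = A"
  proof -
    have "A * P = V * (?D * (U\<^sup>T * P))"
      unfolding A2 using U V P dimD by (simp add: mult_assoc_dim)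
    then show ?thesis by (simp add: UP flip: A2)
  qed
  have AQ: "A * (1\<^sub>m q - P) = 0\<^sub>m q q"
    using mult_minus_distrib_mat[OF A _ P, of "1\<^sub>m q"] A AP by simp
  have Nc: "N \<in> carrier_mat l q"
    unfolding N_def by (intro mult_carrier_mat[of _ l q] minus_carrier_mat P) (use X in auto)
  \<comment> \<open>The vanishing of \<open>A\<close> on the complement of the range of
    \<open>U\<close> passes to \<open>X\<^sup>T\<close> itself: \<open>K\<close> is definite and
    sits in the middle of \<open>A\<close>.\<close>
  have "N\<^sup>T * K * N = (1\<^sub>m q - P)\<^sup>T * (A * (1\<^sub>m q - P))"
    using X Kc P unfolding N_def A_def by (simp add: transpose_mult_dim mult_assoc_dim)
  also have "\<dots> = 0\<^sub>m q q" using P by (simp add: AQ)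
  finally have N0: "N = 0\<^sub>m l q" using sym_pos_def_congruence_zero[OF K Nc] by simp
  have "X\<^sup>T - X\<^sup>T * P = 0\<^sub>m l q"
    using N0 mult_minus_distrib_mat[of "X\<^sup>T" l q "1\<^sub>m q" q P] X P by (simp add: N_def)
  then have "(X\<^sup>T - X\<^sup>T * P) $$ (i, j) = 0" if "i < l" "j < q" for i j using that by simp
  then have XP: "X\<^sup>T * P = X\<^sup>T"
    using X P by (intro eq_matI) auto
  have "X = P * X"
    using arg_cong[OF XP, of transpose_mat] X P Ps by (simp add: transpose_mult_dim)
  then show X': "X = U * (U\<^sup>T * X)"
    using U X by (simp add: P_def mult_assoc_dim)
  define B where "B = (U\<^sup>T * X) * K * (U\<^sup>T * X)\<^sup>T"
  have Bc: "B \<in> carrier_mat l l" unfolding B_def using U X by (intro carrier_matI) auto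
  have Bs: "B\<^sup>T = B"
    using X U Kc Ks by (simp add: B_def transpose_mult_dim mult_assoc_dim)
  have "B * U\<^sup>T = U\<^sup>T * (A * P)"
    using X U Kc by (simp add: B_def A_def P_def transpose_mult_dim mult_assoc_dim)
  also have "\<dots> = (U\<^sup>T * U) * (?D * V\<^sup>T)"
    unfolding AP unfolding A1 using U V dimD by (simp add: mult_assoc_dim)
  also have "\<dots> = ?D * V\<^sup>T" using V dimD by (simp add: UU)
  finally have BU: "B * U\<^sup>T = ?D * V\<^sup>T" .
  have UB: "U * B = V * ?D"
    using arg_cong[OF BU, of transpose_mat] U V Bc dimD by (simp add: transpose_mult_dim Bs Ds)
  \<comment> \<open>Inserting \<open>U\<^sup>T * U = 1\<close> between the factors makes both known
    products \<open>BU\<close> and \<open>UB\<close> appear.\<close>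
  have "B * B = B * ((U\<^sup>T * U) * B)" using Bc by (simp add: UU)
  also have "\<dots> = (B * U\<^sup>T) * (U * B)" using U Bc by (simp add: mult_assoc_dim)
  also have "\<dots> = ?D * ((V\<^sup>T * V) * ?D)"
    unfolding BU UB using V dimD by (simp add: mult_assoc_dim)
  also have "\<dots> = ?D * ?D" by (simp only: VV left_mult_one_mat[OF D])
  finally have sq: "B * B = ?D * ?D" .
  have psd: "0 \<le> x \<bullet> (B *\<^sub>v x)" if x: "x \<in> carrier_vec l" for x
  proof -
    define y where "y = (U\<^sup>T * X)\<^sup>T *\<^sub>v x"
    have y: "y \<in> carrier_vec l" using X by (intro carrier_vecI) (simp add: y_def)
    have "x \<bullet> (B *\<^sub>v x) = y \<bullet> (K *\<^sub>v y)"
      using quadratic_form_congruence[OF Kc, of "(U\<^sup>T * X)\<^sup>T" l x] U X x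
      by (simp add: B_def y_def)
    moreover have "0 \<le> y \<bullet> (K *\<^sub>v y)"
    proof (cases "y = 0\<^sub>v l")
      case True
      have "0\<^sub>v l \<bullet> (K *\<^sub>v 0\<^sub>v l) = 0" using Kc by (intro scalar_prod_left_zero) auto
      with True show ?thesis by simp
    next
      case False
      with y K show ?thesis by (auto simp: sym_pos_def_mat_def intro: less_imp_le)
    qed
    ultimately show ?thesis by simp
  qed
  show "(U\<^sup>T * X) * K * (U\<^sup>T * X)\<^sup>T = ?D"
    using psd_square_root_unique_diag[OF Bc psd d sq] unfolding B_def .
qed

section \<open>Rank bound and truncation to the leading columns\<close>

text \<open>The rank is the size of a maximal independent set of columns, which lives in a space of
  dimension \<open>n\<close>. For \<open>G k\<close> this yields \<open>l\<close> at most
  \<open>q\<close>.\<close>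

lemma (in vec_space) rank_le_nr:
  assumes A: "A \<in> carrier_mat n nc"
  shows "rank A \<le> n"
proof -
  have "lin_indpt {}" by (rule finite_lin_indpt2) auto
  then obtain S where S: "maximal S (\<lambda>T. T \<subseteq> set (cols A) \<and> lin_indpt T)"
    using maximal_exists_superset[of "set (cols A)" "\<lambda>T. T \<subseteq> set (cols A) \<and> lin_indpt T" "{}"]
    by blast
  then have "S \<subseteq> carrier_vec n" "lin_indpt S"
    using A cols_dim[of A] by (auto simp: maximal_def)
  then have "card S \<le> n" using li_le_dim(2) dim_is_n by simp
  then show ?thesis using rank_card_indpt[OF A S] by simp
qed

text \<open>For \<open>l\<close> at most \<open>q\<close> these are the leading columns of the
  identity. They turn both selecting columns and padding a block with zeros into matrix
  products.\<close>

definition coord_incl :: "nat \<Rightarrow> nat \<Rightarrow> real mat" where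
  "coord_incl q l = mat q l (\<lambda>(i, j). if i = j then 1 else 0)"

lemma coord_incl_carrier [simp]: "coord_incl q l \<in> carrier_mat q l"
  by (simp add: coord_incl_def)

lemma coord_incl_transpose_mult:
  assumes "l \<le> q"
  shows "(coord_incl q l)\<^sup>T * coord_incl q l = 1\<^sub>m l"
proof (rule eq_matI)
  fix i j assume ij: "i < dim_row (1\<^sub>m l)" "j < dim_col (1\<^sub>m l)"
  have "((coord_incl q l)\<^sup>T * coord_incl q l) $$ (i, j)
      = (\<Sum>a = 0..<q. (if a = i then 1 else 0) * (if a = j then 1 else 0))"
    using ij by (simp add: coord_incl_def scalar_prod_def)
  also have "\<dots> = (\<Sum>a = 0..<q. if a = i then (if i = j then 1 else 0) else 0)"
    by (rule sum.cong) auto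
  finally have "((coord_incl q l)\<^sup>T * coord_incl q l) $$ (i, j) = \<dots>" .
  then show "((coord_incl q l)\<^sup>T * coord_incl q l) $$ (i, j) = 1\<^sub>m l $$ (i, j)"
    using ij assms by simp
qed (auto simp: coord_incl_def)

lemma mult_coord_incl:
  assumes W: "W \<in> carrier_mat n q" and "l \<le> q"
  shows "W * coord_incl q l = mat_of_cols n (map (col W) [0..<l])"
proof (rule eq_matI)
  fix i j assume ij: "i < dim_row (mat_of_cols n (map (col W) [0..<l]))"
    "j < dim_col (mat_of_cols n (map (col W) [0..<l]))"
  have "(W * coord_incl q l) $$ (i, j) = (\<Sum>a = 0..<q. W $$ (i, a) * (if a = j then 1 else 0))"
    using ij W assms by (simp add: coord_incl_def scalar_prod_def)
  also have "\<dots> = (\<Sum>a = 0..<q. if a = j then W $$ (i, j) else 0)"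
    by (rule sum.cong) auto
  finally have "(W * coord_incl q l) $$ (i, j) = \<dots>" .
  then show "(W * coord_incl q l) $$ (i, j) = mat_of_cols n (map (col W) [0..<l]) $$ (i, j)"
    using ij assms by (simp add: mat_of_cols_def)
qed (use W in \<open>auto simp: coord_incl_def\<close>)

lemma coord_incl_diag_mult:
  assumes "l \<le> q"
  shows "coord_incl q l * mat_diag l d * (coord_incl q l)\<^sup>T
    = four_block_mat (mat_diag l d) (0\<^sub>m l (q - l)) (0\<^sub>m (q - l) l) (0\<^sub>m (q - l) (q - l))"
    (is "?L = ?R")
proof (rule eq_matI)
  fix i j assume ij: "i < dim_row ?R" "j < dim_col ?R"
  \<comment> \<open>The block matrix has size \<open>l + (q - l)\<close>, with truncated
    subtraction; this is \<open>q\<close> because \<open>l\<close> is at most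
    \<open>q\<close>.\<close>
  then have ij': "i < q" "j < q" using assms by (auto simp: mat_diag_def)
  have "?L $$ (i, j) = (\<Sum>a = 0..<l. (if i = a then 1 else 0) * d a * (if j = a then 1 else 0))"
    unfolding mat_diag_mult_right[OF coord_incl_carrier]
    using ij' by (simp add: coord_incl_def scalar_prod_def)
  also have "\<dots> = (\<Sum>a = 0..<l. if a = i then (if i = j then d i else 0) else 0)"
    by (rule sum.cong) auto
  also have "\<dots> = ?R $$ (i, j)" using ij' by (auto simp: mat_diag_def)
  finally show "?L $$ (i, j) = ?R $$ (i, j)" .
qed (use assms in \<open>auto simp: coord_incl_def mat_diag_def\<close>)

lemma orthogonal_mult_coord_incl:
  assumes "real_orthogonal_mat q W" "l \<le> q"
  shows "(W * coord_incl q l)\<^sup>T * (W * coord_incl q l) = 1\<^sub>m l"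
proof -
  have W: "W \<in> carrier_mat q q" "W\<^sup>T * W = 1\<^sub>m q"
    using assms by (auto simp: real_orthogonal_mat_def)
  have E: "dim_row (coord_incl q l) = q" "dim_col (coord_incl q l) = l"
    by (auto simp: coord_incl_def)
  have "(W * coord_incl q l)\<^sup>T * (W * coord_incl q l)
      = (coord_incl q l)\<^sup>T * ((W\<^sup>T * W) * coord_incl q l)"
    using W(1) E by (simp add: transpose_mult_dim mult_assoc_dim)
  then show ?thesis
    using coord_incl_transpose_mult[OF assms(2)] E by (simp add: W(2))
qed

section \<open>From the full decomposition to the consistency of the guess\<close>

theorem theorem4:
  fixes l q k :: nat
    and H G R Ht Gt U V D S Hh Gh Rh :: "nat \<Rightarrow> real mat"
    and \<sigma> :: "nat \<Rightarrow> nat \<Rightarrow> real"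
  assumes "sym_pos_def_mat l (H k)"
    and "G k \<in> carrier_mat q l" and "vec_space.rank q (G k) = l"
    and "R k \<in> carrier_mat l l" and "invertible_mat (R k)"
    and "Ht k = (R k)\<^sup>T * H k * R k"
    and "Gt k = G k * R k"
    and "real_orthogonal_mat q (U k)"
    and "real_orthogonal_mat q (V k)"
    and "\<forall>i j. i \<le> j \<and> j < l \<longrightarrow> \<sigma> k j \<le> \<sigma> k i"
    and "\<forall>i<l. 0 < \<sigma> k i"
    and "D k = mat_diag l (\<sigma> k)"
    and "S k = four_block_mat (D k) (0\<^sub>m l (q - l)) (0\<^sub>m (q - l) l) (0\<^sub>m (q - l) (q - l))"
    and "Gt k * mat_inv (Ht k) * (Gt k)\<^sup>T = U k * S k * (V k)\<^sup>T"
    and "Hh k = mat_inv (D k)"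
    and "Gh k = mat_of_cols q (map (col (U k)) [0..<l])"
    and "Rh k = (Gh k)\<^sup>T * Gt k"
  shows "Ht k = (Rh k)\<^sup>T * Hh k * Rh k \<and> Gt k = Gh k * Rh k"
proof -
  have Gt: "Gt k \<in> carrier_mat q l" using assms(2,4,7) by simp
  have lq: "l \<le> q" using vec_space.rank_le_nr[OF assms(2)] assms(3) by simp
  \<comment> \<open>\<open>invertible_mat\<close> yields an inverse without stating its size;
    counting columns in the two inverse equations gives both dimensions.\<close>
  obtain Q where Q: "Q \<in> carrier_mat l l" "Q * R k = 1\<^sub>m l"
  proof -
    obtain B where B: "R k * B = 1\<^sub>m l" "B * R k = 1\<^sub>m (dim_row B)"
      using assms(4,5) by (auto simp: invertible_mat_def inverts_mat_def)
    have "dim_col B = l" using arg_cong[OF B(1), of dim_col] by simp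
    moreover have "dim_row B = l" using arg_cong[OF B(2), of dim_col] assms(4) by simp
    ultimately show ?thesis using that[of B] B by auto
  qed
  have Ht: "sym_pos_def_mat l (Ht k)"
    unfolding assms(6) by (rule sym_pos_def_congruence[OF assms(1,4) Q])
  then have Htc: "Ht k \<in> carrier_mat l l" by (simp add: sym_pos_def_mat_def)
  define K where "K = mat_inv (Ht k)"
  note inv = mat_inv_nonsingular[OF Htc sym_pos_def_det_nonzero[OF Ht], folded K_def]
  define E where "E = coord_incl q l"
  have E: "E \<in> carrier_mat q l" by (simp add: E_def)
  have U: "U k \<in> carrier_mat q q" and V: "V k \<in> carrier_mat q q"
    using assms(8,9) by (auto simp: real_orthogonal_mat_def)
  have Gh: "Gh k = U k * E" unfolding assms(16) E_def by (rule mult_coord_incl[OF U lq, symmetric])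
  have Dc: "D k \<in> carrier_mat l l" unfolding assms(12) by simp
  have S: "S k = E * D k * E\<^sup>T"
    unfolding assms(13) assms(12) E_def by (rule coord_incl_diag_mult[OF lq, symmetric])
  \<comment> \<open>Absorbing the two copies of \<open>E\<close> from \<open>S k\<close> into the
    orthogonal factors leaves the thin decomposition.\<close>
  have "Gt k * K * (Gt k)\<^sup>T = U k * E * D k * (V k * E)\<^sup>T"
    unfolding K_def assms(14) S using U V E Dc by (simp add: transpose_mult_dim mult_assoc_dim)
  then have svd: "Gt k * K * (Gt k)\<^sup>T = Gh k * mat_diag l (\<sigma> k) * (V k * E)\<^sup>T"
    unfolding Gh assms(12) .
  have Ghc: "Gh k \<in> carrier_mat q l" and VE: "V k * E \<in> carrier_mat q l"
    using U V E by (auto simp: Gh)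
  have orth: "(Gh k)\<^sup>T * Gh k = 1\<^sub>m l" "(V k * E)\<^sup>T * (V k * E) = 1\<^sub>m l"
    unfolding Gh E_def using orthogonal_mult_coord_incl assms(8,9) lq by auto
  \<comment> \<open>After folding, \<open>thin(1)\<close> is the factorization of
    \<open>Gt k\<close>, and \<open>thin(2)\<close> says that
    \<open>Rh k * K * (Rh k)\<^sup>T\<close> is the diagonal matrix \<open>D k\<close>.\<close>
  note thin = thin_svd_of_congruence[OF sym_pos_def_mat_inv[OF Ht, folded K_def] Gt Ghc VE orth
      assms(11) svd, folded assms(17)]
  have Rh: "Rh k \<in> carrier_mat l l" unfolding assms(17) using Ghc Gt by auto
  have Hh: "Hh k \<in> carrier_mat l l" "Hh k * D k = 1\<^sub>m l"
  proof -
    have eq: "Hh k = mat_diag l (\<lambda>i. inverse (\<sigma> k i))"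
      unfolding assms(15,12) using assms(11) by (intro mat_inv_mat_diag) auto
    then show "Hh k \<in> carrier_mat l l" by simp
    show "Hh k * D k = 1\<^sub>m l"
      unfolding eq assms(12) using assms(11)
      by (subst mat_diag_mult_left[of _ l l]) (auto simp: mat_diag_def intro!: eq_matI)
  qed
  \<comment> \<open>Since \<open>Hh Rh K Rh\<^sup>T = 1\<close>, the square matrix \<open>Rh\<^sup>T\<close> is also a left inverse of \<open>Hh Rh K\<close>.\<close>
  have "(Hh k * Rh k * K) * (Rh k)\<^sup>T = Hh k * (Rh k * K * (Rh k)\<^sup>T)"
    using Hh(1) Rh inv(1) by (simp add: mult_assoc_dim)
  also have "\<dots> = 1\<^sub>m l" unfolding thin(2) using Hh(2) assms(12) by simp
  finally have one: "(Hh k * Rh k * K) * (Rh k)\<^sup>T = 1\<^sub>m l" .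
  have "(Rh k)\<^sup>T * (Hh k * Rh k * K) = 1\<^sub>m l"
  proof (rule mat_mult_left_right_inverse[OF _ _ one])
    show "Hh k * Rh k * K \<in> carrier_mat l l"
      using Hh(1) inv(1) by (intro carrier_matI) auto
    show "(Rh k)\<^sup>T \<in> carrier_mat l l" using Rh by simp
  qed
  then have "((Rh k)\<^sup>T * Hh k * Rh k) * K = 1\<^sub>m l"
    using Hh(1) Rh inv(1) by (simp add: mult_assoc_dim)
  \<comment> \<open>Multiplying by \<open>Ht k\<close> on the right cancels \<open>K\<close>, which
    isolates the formula for \<open>Ht k\<close>.\<close>
  then have "((Rh k)\<^sup>T * Hh k * Rh k) * K * Ht k = Ht k" using Htc by simp
  moreover have "((Rh k)\<^sup>T * Hh k * Rh k) * K * Ht k = (Rh k)\<^sup>T * Hh k * Rh k * (K * Ht k)"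
    using Hh(1) Rh inv(1) Htc by (simp add: mult_assoc_dim)
  moreover have "(Rh k)\<^sup>T * Hh k * Rh k * (K * Ht k) = (Rh k)\<^sup>T * Hh k * Rh k"
    using Hh(1) Rh unfolding inv(2) by (intro right_mult_one_mat[of _ l]) auto
  ultimately show ?thesis using thin(1) by metis
qed

end
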